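(* Let $X$ be a finite polyhedron, let $f:X\to D_n(X)$ be an $n$-valued map, and let $F/q$ be the associated finite-valued map, with $q:\hat X\to X$ and $F:\hat X\to X$, where $\hat X=\Gamma_f$. Then there is an irreducible partition $f=\{f_1,\dots,f_k\}$ if and only if $\hat X$ has $k$ components, and in this case we have $f_i=F_i\circ q^{-1}$ for each $i$, where $F_1,\dots,F_k$ are the component maps of $F$.
   Context: For a space $X$, $D_n(X)$ is the space of unordered $n$-element subsets of $X$, topologized as the quotient, by forgetting the ordering, of $F_n(X)=\{(x_1,\dots,x_n)\in X^n\mid x_i\ne x_j\text{ for } i\neq j\}$ (subspace topology from $X^n$). An $n$-valued map is a continuous function $f:X\to D_n(X)$. A submap of $f$ is a $k$-valued map $g:X\to D_k(X)$ ($k\le n$) with $g(x)\subseteq f(x)$ for all $x$; it is proper if $k<n$; a map with no proper submap is irreducible. A partition of $f$ is a set $\{f_1,\dots,f_s\}$ of $k_i$-valued maps $f_i:X\to D_{k_i}(X)$ with positive integers $k_1+\dots+k_s=n$ and $f(x)=f_1(x)\cup\dots\cup f_s(x)$ for every $x$ (written $f=\{f_1,\dots,f_s\}$; $s=1$ is allowed); it is an irreducible partition if every $f_i$ is irreducible. A finite-valued map $F/q$ on $X$ (with cardinality at most $n$) consists of a finite ($n$-fold) covering map $q:\hat X\to X$ and a map $F:\hat X\to X$; it defines the multivalued map $x\mapsto F(q^{-1}(x))$. The graph of $f:X\to D_n(X)$ is $\Gamma_f=\{(x,y)\in X\times X\mid y\in f(x)\}$. The finite-valued map associated to $f$ is $F/q$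 with $\hat X=\Gamma_f$, $q(x,y)=x$ and $F(x,y)=y$; it satisfies $f=F\circ q^{-1}$. If $\hat X_1,\dots,\hat X_k$ are the components of $\hat X$, then $F$ decomposes into the component maps $F_i:\hat X_i\to X$, the restrictions of $F$; in $F_i\circ q^{-1}$, $q$ is understood as restricted to $\hat X_i$, so $(F_i\circ q^{-1})(x)=F_i(q^{-1}(x)\cap\hat X_i)$.
   Formalization: X is additionally assumed connected and nonempty; for disconnected X the claim is false (X two points, n=1, f(x)={x} is irreducible but its graph has two components). *)

theory Defs
  imports "HOL-Analysis.Analysis"
begin

text \<open>Ordered configurations: \<open>n\<close>-tuples are extensional functions on \<open>{..<n}\<close>.\<close>

definition ordered_conf :: "nat \<Rightarrow> 'a topology \<Rightarrow> (nat \<Rightarrow> 'a) topology" where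
  "ordered_conf n X =
     subtopology (product_topology (\<lambda>_. X) {..<n}) {x. inj_on x {..<n}}"

definition forget_order :: "nat \<Rightarrow> (nat \<Rightarrow> 'a) \<Rightarrow> 'a set" where
  "forget_order n x = x ` {..<n}"

definition quotient_top :: "'a topology \<Rightarrow> ('a \<Rightarrow> 'b) \<Rightarrow> 'b topology" where
  "quotient_top Y p =
     topology (\<lambda>U. U \<subseteq> p ` topspace Y \<and> openin Y {y \<in> topspace Y. p y \<in> U})"

definition unordered_conf :: "nat \<Rightarrow> 'a topology \<Rightarrow> 'a set topology" where
  "unordered_conf n X = quotient_top (ordered_conf n X) (forget_order n)"

lemma openin_quotient_top:
  "openin (quotient_top Y p) U \<longleftrightarrow>
     U \<subseteq> p ` topspace Y \<and> openin Y {y \<in> topspace Y. p y \<in> U}"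
proof -
  have "istopology (\<lambda>U. U \<subseteq> p ` topspace Y \<and> openin Y {y \<in> topspace Y. p y \<in> U})"
    unfolding istopology_def
  proof (intro conjI allI impI)
    fix S T
    assume "S \<subseteq> p ` topspace Y \<and> openin Y {y \<in> topspace Y. p y \<in> S}"
      and "T \<subseteq> p ` topspace Y \<and> openin Y {y \<in> topspace Y. p y \<in> T}"
    moreover have "{y \<in> topspace Y. p y \<in> S \<inter> T} =
        {y \<in> topspace Y. p y \<in> S} \<inter> {y \<in> topspace Y. p y \<in> T}" by blast
    ultimately show "S \<inter> T \<subseteq> p ` topspace Y"
      "openin Y {y \<in> topspace Y. p y \<in> S \<inter> T}" by auto
  next
    fix \<K>
    assume *: "\<forall>K\<in>\<K>. K \<subseteq> p ` topspace Y \<and> openin Y {y \<in> topspace Y. p y \<in> K}"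
    have "{y \<in> topspace Y. p y \<in> \<Union>\<K>} = (\<Union>K\<in>\<K>. {y \<in> topspace Y. p y \<in> K})" by blast
    then show "openin Y {y \<in> topspace Y. p y \<in> \<Union>\<K>}" using * by auto
    show "\<Union>\<K> \<subseteq> p ` topspace Y" using * by blast
  qed
  then show ?thesis by (simp add: quotient_top_def)
qed

lemma topspace_quotient_top: "topspace (quotient_top Y p) = p ` topspace Y"
proof -
  have "{y \<in> topspace Y. p y \<in> p ` topspace Y} = topspace Y" by blast
  then have "openin (quotient_top Y p) (p ` topspace Y)" by (simp add: openin_quotient_top)
  then have "p ` topspace Y \<subseteq> topspace (quotient_top Y p)" by (rule openin_subset)
  moreover have "topspace (quotient_top Y p) \<subseteq> p ` topspace Y"
    using openin_topspace [of "quotient_top Y p"] unfolding openin_quotient_top by blast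
  ultimately show ?thesis by (rule equalityI [rotated])
qed

lemma quotient_map_quotient_top: "quotient_map Y (quotient_top Y p) p"
  by (auto simp: quotient_map_def topspace_quotient_top openin_quotient_top)

lemma topspace_unordered_conf:
  "topspace (unordered_conf n X) = {S. S \<subseteq> topspace X \<and> finite S \<and> card S = n}"
proof -
  have "S \<in> forget_order n ` topspace (ordered_conf n X)"
    if S: "S \<subseteq> topspace X" "finite S" "card S = n" for S
  proof -
    obtain h where h: "bij_betw h {..<n} S"
      using ex_bij_betw_nat_finite [OF S(2)] S(3) by (auto simp: atLeast0LessThan)
    have "restrict h {..<n} \<in> {..<n} \<rightarrow>\<^sub>E topspace X"
      using bij_betwE [OF h] S(1) by (auto simp: PiE_iff)
    moreover have "inj_on (restrict h {..<n}) {..<n}"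
      using bij_betw_imp_inj_on [OF h] by (simp add: inj_on_def)
    ultimately have "restrict h {..<n} \<in> topspace (ordered_conf n X)"
      by (simp add: ordered_conf_def)
    moreover have "forget_order n (restrict h {..<n}) = S"
      using bij_betw_imp_surj_on [OF h] by (simp add: forget_order_def)
    ultimately show ?thesis by blast
  qed
  moreover have "forget_order n x \<subseteq> topspace X \<and> finite (forget_order n x) \<and>
      card (forget_order n x) = n" if "x \<in> topspace (ordered_conf n X)" for x
    using that by (auto simp: ordered_conf_def forget_order_def card_image PiE_iff)
  ultimately show ?thesis
    unfolding unordered_conf_def topspace_quotient_top
    by (intro equalityI subsetI) auto
qed

text \<open>A multivalued map is a function \<open>'a \<Rightarrow> 'a set\<close>; only its values on \<^term>\<open>topspace X\<close> matter.\<close>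

definition n_valued_map :: "nat \<Rightarrow> 'a topology \<Rightarrow> ('a \<Rightarrow> 'a set) \<Rightarrow> bool" where
  "n_valued_map n X f \<longleftrightarrow> continuous_map X (unordered_conf n X) f"

text \<open>The cardinality of a submap is positive: otherwise the constant map to the empty set would be
  a proper submap of every map, and nothing would be irreducible.\<close>

definition submap :: "nat \<Rightarrow> ('a \<Rightarrow> 'a set) \<Rightarrow> nat \<Rightarrow> 'a topology \<Rightarrow> ('a \<Rightarrow> 'a set) \<Rightarrow> bool" where
  "submap k g n X f \<longleftrightarrow>
     0 < k \<and> k \<le> n \<and> n_valued_map k X g \<and> (\<forall>x \<in> topspace X. g x \<subseteq> f x)"

definition irreducible_map :: "nat \<Rightarrow> 'a topology \<Rightarrow> ('a \<Rightarrow> 'a set) \<Rightarrow> bool" where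
  "irreducible_map n X f \<longleftrightarrow> n_valued_map n X f \<and> \<not> (\<exists>k g. submap k g n X f \<and> k < n)"

text \<open>The parts \<open>fs 0, \<dots>, fs (s - 1)\<close> have cardinalities \<open>ks 0, \<dots>, ks (s - 1)\<close>. On a nonempty
  space the parts are pairwise distinct, as their values are nonempty and, since the
  cardinalities sum to \<open>n\<close>, pairwise disjoint; so indexing agrees with a set of \<open>s\<close> maps.\<close>

definition map_partition ::
  "nat \<Rightarrow> 'a topology \<Rightarrow> ('a \<Rightarrow> 'a set) \<Rightarrow> nat \<Rightarrow> (nat \<Rightarrow> nat) \<Rightarrow> (nat \<Rightarrow> 'a \<Rightarrow> 'a set) \<Rightarrow> bool" where
  "map_partition n X f s ks fs \<longleftrightarrow>
     (\<forall>i<s. 0 < ks i \<and> n_valued_map (ks i) X (fs i)) \<and>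
     (\<Sum>i<s. ks i) = n \<and>
     (\<forall>x \<in> topspace X. f x = (\<Union>i<s. fs i x))"

definition irreducible_partition ::
  "nat \<Rightarrow> 'a topology \<Rightarrow> ('a \<Rightarrow> 'a set) \<Rightarrow> nat \<Rightarrow> (nat \<Rightarrow> 'a \<Rightarrow> 'a set) \<Rightarrow> bool" where
  "irreducible_partition n X f s fs \<longleftrightarrow>
     (\<exists>ks. map_partition n X f s ks fs \<and> (\<forall>i<s. irreducible_map (ks i) X (fs i)))"

definition graph_space :: "'a topology \<Rightarrow> ('a \<Rightarrow> 'a set) \<Rightarrow> ('a \<times> 'a) topology" where
  "graph_space X f =
     subtopology (prod_topology X X) {(x, y). x \<in> topspace X \<and> y \<in> topspace X \<and> y \<in> f x}"

text \<open>\<open>fiber_image F q S x\<close> is \<open>F (q\<^sup>-\<^sup>1(x) \<inter> S)\<close>, the value at \<open>x\<close> of \<open>F \<circ> q\<^sup>-\<^sup>1\<close> with \<open>F\<close> and \<open>q\<close>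
  restricted to \<open>S\<close>. For the finite-valued map associated to \<open>f\<close>, the covering space is
  \<^term>\<open>graph_space X f\<close>, with \<^term>\<open>q = fst\<close> and \<^term>\<open>F = snd\<close>.\<close>

definition fiber_image :: "('c \<Rightarrow> 'b) \<Rightarrow> ('c \<Rightarrow> 'a) \<Rightarrow> 'c set \<Rightarrow> 'a \<Rightarrow> 'b set" where
  "fiber_image F q S x = F ` {z \<in> S. q z = x}"

lemma fiber_image_graph_space:
  assumes "n_valued_map n X f" and "x \<in> topspace X"
  shows "fiber_image snd fst (topspace (graph_space X f)) x = f x"
proof -
  have "f x \<in> topspace (unordered_conf n X)"
    using assms continuous_map_image_subset_topspace unfolding n_valued_map_def by blast
  then have "f x \<subseteq> topspace X" by (simp add: topspace_unordered_conf)
  then show ?thesis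
    using assms(2) by (force simp: fiber_image_def graph_space_def)
qed

text \<open>A finite polyhedron is a space homeomorphic to the underlying space of a finite simplicial
  complex (\<^const>\<open>simplicial_complex\<close> includes finiteness).\<close>

definition triangulated_by :: "'a topology \<Rightarrow> 'e::euclidean_space set set \<Rightarrow> bool" where
  "triangulated_by X \<K> \<longleftrightarrow>
     simplicial_complex \<K> \<and> X homeomorphic_space top_of_set (\<Union>\<K>)"

end

theory Submission
  imports Defs
begin

text \<open>
  On a Hausdorff space, continuity into the unordered configuration space amounts to lower
  hemicontinuity together with constant cardinality of the values. If \<open>g\<close> is a submap of \<open>f\<close>, then
  so is the complement \<open>f - g\<close>, and graphs of \<open>m\<close>-valued maps are closed; hence graphs of submaps
  are clopen in the graph of \<open>f\<close>. Conversely, the cardinality of the fibres of a clopen subset and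
  of its complement are both lower semicontinuous with constant sum \<open>n\<close>, so over a connected base
  each clopen subset is the graph of a submap. Therefore a map is irreducible iff its graph is
  connected, and irreducible partitions correspond to decompositions of the graph into
  connected clopen pieces, which must be the components.
\<close>

section \<open>Lower hemicontinuity and separation of finite sets\<close>

definition lower_hemicontinuous :: "'a topology \<Rightarrow> 'b topology \<Rightarrow> ('a \<Rightarrow> 'b set) \<Rightarrow> bool" where
  "lower_hemicontinuous X Y g \<longleftrightarrow>
     (\<forall>V. openin Y V \<longrightarrow> openin X {x \<in> topspace X. g x \<inter> V \<noteq> {}})"

text \<open>Each point has to be kept away from only finitely many others, so its pairwise
  separating neighbourhoods may be intersected.\<close>

lemma Hausdorff_space_separate_finite:
  assumes "Hausdorff_space X" "finite S" "S \<subseteq> topspace X"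
  obtains V where "\<And>y. y \<in> S \<Longrightarrow> openin X (V y)" "\<And>y. y \<in> S \<Longrightarrow> y \<in> V y" "disjoint_family_on V S"
proof -
  have "\<exists>U W. y \<in> S \<and> z \<in> S \<and> y \<noteq> z \<longrightarrow>
      openin X U \<and> openin X W \<and> y \<in> U \<and> z \<in> W \<and> disjnt U W" for y z
  proof (cases "y \<in> S \<and> z \<in> S \<and> y \<noteq> z")
    case True
    then have "y \<in> topspace X" "z \<in> topspace X" "y \<noteq> z" using assms(3) by auto
    then have "\<exists>U W. openin X U \<and> openin X W \<and> y \<in> U \<and> z \<in> W \<and> disjnt U W"
      using assms(1) by (simp add: Hausdorff_space_def)
    then show ?thesis by blast
  next
    case False
    then show ?thesis by (intro exI impI) (erule notE)
  qed
  then obtain U W where "\<And>y z. y \<in> S \<and> z \<in> S \<and> y \<noteq> z \<longrightarrow>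
      openin X (U y z) \<and> openin X (W y z) \<and> y \<in> U y z \<and> z \<in> W y z \<and> disjnt (U y z) (W y z)"
    by metis
  then have UW: "openin X (U y z)" "openin X (W y z)" "y \<in> U y z" "z \<in> W y z"
      "disjnt (U y z) (W y z)" if "y \<in> S" "z \<in> S" "y \<noteq> z" for y z
    using that by blast+
  \<comment> \<open>The chosen \<open>U\<close> and \<open>W\<close> need not be symmetric, so
    \<open>V y\<close> takes the side of \<open>y\<close> in both orders, \<open>U y z\<close> and
    \<open>W z y\<close>. Intersecting with \<open>topspace X\<close> yields an open set even when
    \<open>S = {y}\<close>.\<close>
  define V where "V y = (\<Inter>z \<in> S - {y}. U y z \<inter> W z y) \<inter> topspace X" for y
  show thesis
  proof
    show "openin X (V y)" if "y \<in> S" for y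
      unfolding V_def using assms(2) that UW by (intro openin_INT) auto
    show "y \<in> V y" if "y \<in> S" for y
      using assms(3) that UW(3)[of y] UW(4)[of _ y] unfolding V_def by blast
    show "disjoint_family_on V S"
      unfolding disjoint_family_on_def
    proof (intro ballI impI)
      fix y z assume "y \<in> S" "z \<in> S" "y \<noteq> z"
      then have "V y \<subseteq> U y z" "V z \<subseteq> W y z" "disjnt (U y z) (W y z)"
        using UW by (auto simp: V_def)
      then show "V y \<inter> V z = {}" by (auto simp: disjnt_def)
    qed
  qed
qed

text \<open>Hitting one \<open>V y\<close> is an open condition on the argument, and finitely many
  such conditions hold together near \<open>x0\<close>.\<close>

lemma lower_hemicontinuous_finite_nbhd:
  assumes "lower_hemicontinuous X Y g" "x0 \<in> topspace X" "finite S"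
    and "\<And>y. y \<in> S \<Longrightarrow> openin Y (V y)" "\<And>y. y \<in> S \<Longrightarrow> g x0 \<inter> V y \<noteq> {}"
  obtains U where "openin X U" "x0 \<in> U" "\<And>x y. x \<in> U \<Longrightarrow> y \<in> S \<Longrightarrow> g x \<inter> V y \<noteq> {}"
proof
  let ?U = "(\<Inter>y\<in>S. {x \<in> topspace X. g x \<inter> V y \<noteq> {}}) \<inter> topspace X"
  show "openin X ?U"
    using assms unfolding lower_hemicontinuous_def by (intro openin_INT) auto
  show "x0 \<in> ?U" using assms by auto
qed auto

text \<open>Turns hitting conditions into counting: points of \<open>T\<close> chosen in disjoint
  sets are distinct, so they exhaust \<open>T\<close> whenever \<open>S\<close> and \<open>T\<close>
  are finite of equal size.\<close>

lemma disjoint_transversal: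
  assumes "disjoint_family_on V S" "\<And>y. y \<in> S \<Longrightarrow> T \<inter> V y \<noteq> {}"
  obtains h where "inj_on h S" "h ` S \<subseteq> T" "\<And>y. y \<in> S \<Longrightarrow> h y \<in> V y"
proof -
  have "\<forall>y\<in>S. \<exists>z. z \<in> T \<inter> V y" using assms(2) by blast
  then obtain h where h: "\<forall>y\<in>S. h y \<in> T \<inter> V y" by (rule bchoice[THEN exE])
  have "inj_on h S"
  proof (rule inj_onI, rule ccontr)
    fix y z assume yz: "y \<in> S" "z \<in> S" "h y = h z" "y \<noteq> z"
    have "h y \<in> V y \<inter> V z" using h yz by (metis IntD2 IntI)
    with disjoint_family_onD[OF assms(1) yz(1,2,4)] show False by simp
  qed
  moreover have "h ` S \<subseteq> T" "\<And>y. y \<in> S \<Longrightarrow> h y \<in> V y" using h by auto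
  ultimately show thesis by (rule that)
qed

section \<open>Continuity into the configuration space\<close>

text \<open>Forwards, the configurations meeting an open \<open>V\<close> pull back to a union of
  cylinders in the ordered space. Backwards, for \<open>x\<close> near \<open>x0\<close> the set
  \<open>f x\<close> has a point in each of \<open>n\<close> disjoint neighbourhoods; having only
  \<open>n\<close> points, it is the range of a tuple close to an ordering of
  \<open>f x0\<close>.\<close>

lemma n_valued_map_iff:
  assumes "Hausdorff_space X"
  shows "n_valued_map n X f \<longleftrightarrow> lower_hemicontinuous X X f \<and>
     (\<forall>x \<in> topspace X. f x \<subseteq> topspace X \<and> finite (f x) \<and> card (f x) = n)" (is "?L \<longleftrightarrow> ?R")
proof
  assume L: ?L
  have "openin (unordered_conf n X) {S \<in> topspace (unordered_conf n X). S \<inter> V \<noteq> {}}"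
    if V: "openin X V" for V
  proof -
    let ?P = "product_topology (\<lambda>_. X) {..<n}"
    have "openin ?P (\<Union>i<n. {x \<in> topspace ?P. x i \<in> V})"
    proof (intro openin_Union ballI, elim imageE, hypsubst)
      fix i assume "i \<in> {..<n}"
      then show "openin ?P {x \<in> topspace ?P. x i \<in> V}"
        using openin_continuous_map_preimage[OF continuous_map_product_projection[of i "{..<n}" "\<lambda>_. X"] V]
        by blast
    qed
    then have "openin (ordered_conf n X)
        ((\<Union>i<n. {x \<in> topspace ?P. x i \<in> V}) \<inter> {x. inj_on x {..<n}})"
      unfolding ordered_conf_def by (rule openin_subtopology_Int)
    moreover have "(\<Union>i<n. {x \<in> topspace ?P. x i \<in> V}) \<inter> {x. inj_on x {..<n}} =
        {x \<in> topspace (ordered_conf n X).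
          forget_order n x \<in> {S \<in> topspace (unordered_conf n X). S \<inter> V \<noteq> {}}}"
      unfolding unordered_conf_def topspace_quotient_top
      by (auto simp: ordered_conf_def forget_order_def)
    moreover have "{S \<in> topspace (unordered_conf n X). S \<inter> V \<noteq> {}}
        \<subseteq> forget_order n ` topspace (ordered_conf n X)"
      unfolding unordered_conf_def topspace_quotient_top by blast
    ultimately show ?thesis
      unfolding unordered_conf_def openin_quotient_top by simp
  qed
  moreover have top: "f x \<in> topspace (unordered_conf n X)" if "x \<in> topspace X" for x
    using L that continuous_map_image_subset_topspace unfolding n_valued_map_def by blast
  ultimately have "openin X {x \<in> topspace X. f x \<inter> V \<noteq> {}}" if "openin X V" for V
  proof -
    have "{x \<in> topspace X. f x \<inter> V \<noteq> {}} =
        {x \<in> topspace X. f x \<in> {S \<in> topspace (unordered_conf n X). S \<inter> V \<noteq> {}}}"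
      using top by blast
    moreover have "openin X {x \<in> topspace X. f x \<in> {S \<in> topspace (unordered_conf n X). S \<inter> V \<noteq> {}}}"
      using L that \<open>\<And>V. openin X V \<Longrightarrow> openin _ _\<close> unfolding n_valued_map_def
      by (intro openin_continuous_map_preimage) auto
    ultimately show ?thesis by simp
  qed
  then show ?R
    using top by (auto simp: lower_hemicontinuous_def topspace_unordered_conf)
next
  assume R: ?R
  show ?L
    unfolding n_valued_map_def continuous_map_def
  proof (intro conjI allI impI)
    show "f \<in> topspace X \<rightarrow> topspace (unordered_conf n X)"
      using R by (auto simp: topspace_unordered_conf)
    fix W assume W: "openin (unordered_conf n X) W"
    show "openin X {x \<in> topspace X. f x \<in> W}"
    proof (subst openin_subopen, intro ballI)
      fix x0 assume "x0 \<in> {x \<in> topspace X. f x \<in> W}"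
      then have x0: "x0 \<in> topspace X" "f x0 \<in> W" by auto
      have "W \<subseteq> forget_order n ` topspace (ordered_conf n X)"
        and pre: "openin (ordered_conf n X) {y \<in> topspace (ordered_conf n X). forget_order n y \<in> W}"
        using W by (auto simp: unordered_conf_def openin_quotient_top)
      \<comment> \<open>\<open>y\<close> is an ordering of \<open>f x0\<close>; around it a basic
        box with sides \<open>B i\<close> is taken inside \<open>P\<close>, whose injective tuples
        are those lying over \<open>W\<close>.\<close>
      then obtain y where y: "y \<in> topspace (ordered_conf n X)" "f x0 = forget_order n y"
        using x0 by blast
      obtain P where P: "openin (product_topology (\<lambda>_. X) {..<n}) P"
        "{y \<in> topspace (ordered_conf n X). forget_order n y \<in> W} = P \<inter> {x. inj_on x {..<n}}"
        using pre by (auto simp: ordered_conf_def openin_subtopology)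
      with x0 y have "y \<in> P" by auto
      then obtain B where B: "\<And>i. i < n \<Longrightarrow> openin X (B i)" "y \<in> Pi\<^sub>E {..<n} B" "Pi\<^sub>E {..<n} B \<subseteq> P"
        using P(1) unfolding openin_product_topology_alt by (metis lessThan_iff)
      have inj: "inj_on y {..<n}" and ytop: "y ` {..<n} \<subseteq> topspace X"
        using y(1) by (auto simp: ordered_conf_def)
      obtain V where V: "\<And>z. z \<in> f x0 \<Longrightarrow> openin X (V z)" "\<And>z. z \<in> f x0 \<Longrightarrow> z \<in> V z"
        "disjoint_family_on V (f x0)"
        using Hausdorff_space_separate_finite[OF assms, of "f x0"] R x0 by metis
      have yi: "y i \<in> f x0" if "i < n" for i
        using that y(2) by (auto simp: forget_order_def)
      \<comment> \<open>The factor \<open>V (y i)\<close> keeps the chosen points distinct, and the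
        factor \<open>B i\<close> keeps the tuple they form inside \<open>P\<close>.\<close>
      let ?V = "\<lambda>i. V (y i) \<inter> B i"
      obtain U where U: "openin X U" "x0 \<in> U" "\<And>x i. x \<in> U \<Longrightarrow> i \<in> {..<n} \<Longrightarrow> f x \<inter> ?V i \<noteq> {}"
      proof (rule lower_hemicontinuous_finite_nbhd[of X X f x0 "{..<n}" ?V])
        show "openin X (?V i)" if "i \<in> {..<n}" for i
          using that V(1) B(1) yi by auto
        show "f x0 \<inter> ?V i \<noteq> {}" if "i \<in> {..<n}" for i
          using that V(2) B(2) yi by (auto simp: PiE_iff)
      qed (use R x0 in auto)
      have dis: "disjoint_family_on ?V {..<n}"
        using V(3) inj yi unfolding disjoint_family_on_def inj_on_def by blast
      have "f x \<in> W" if x: "x \<in> U" for x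
      proof -
        obtain h where h: "inj_on h {..<n}" "h ` {..<n} \<subseteq> f x" "\<And>i. i \<in> {..<n} \<Longrightarrow> h i \<in> ?V i"
          using disjoint_transversal[OF dis, of "f x"] U(3)[OF x] by metis
        have "x \<in> topspace X" using x U(1) openin_subset by blast
        then have fx: "finite (f x)" "card (f x) = n" using R by auto
        \<comment> \<open>Here constant cardinality enters: \<open>n\<close> distinct points of an
          \<open>n\<close>-element set are all of it.\<close>
        have eq: "h ` {..<n} = f x"
          using h fx by (intro card_subset_eq) (auto simp: card_image)
        \<comment> \<open>Tuples are extensional functions, so \<open>h\<close> is restricted before
          it is compared with the box.\<close>
        have "restrict h {..<n} \<in> P"
          using h(3) by (intro subsetD[OF B(3)]) auto
        moreover have "inj_on (restrict h {..<n}) {..<n}"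
          using h(1) by (simp add: inj_on_def)
        ultimately have "forget_order n (restrict h {..<n}) \<in> W"
          using P(2) by blast
        then show ?thesis by (simp add: forget_order_def eq)
      qed
      then show "\<exists>T. openin X T \<and> x0 \<in> T \<and> T \<subseteq> {x \<in> topspace X. f x \<in> W}"
        using U(1,2) openin_subset by blast
    qed
  qed
qed

section \<open>Cardinality of values, separation and complements\<close>

text \<open>The points of \<open>g x0\<close> have disjoint neighbourhoods that \<open>g x\<close>
  still hits for \<open>x\<close> near \<open>x0\<close>, so the number of values cannot drop
  locally.\<close>

lemma openin_card_ge:
  assumes "Hausdorff_space X" "lower_hemicontinuous X X g"
    and g: "\<And>x. x \<in> topspace X \<Longrightarrow> g x \<subseteq> topspace X \<and> finite (g x)"
  shows "openin X {x \<in> topspace X. m \<le> card (g x)}"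
proof (subst openin_subopen, intro ballI)
  fix x0 assume "x0 \<in> {x \<in> topspace X. m \<le> card (g x)}"
  then have x0: "x0 \<in> topspace X" "m \<le> card (g x0)" by auto
  obtain V where V: "\<And>z. z \<in> g x0 \<Longrightarrow> openin X (V z)" "\<And>z. z \<in> g x0 \<Longrightarrow> z \<in> V z"
    "disjoint_family_on V (g x0)"
    using Hausdorff_space_separate_finite[OF assms(1), of "g x0"] g x0 by metis
  obtain U where U: "openin X U" "x0 \<in> U" "\<And>x z. x \<in> U \<Longrightarrow> z \<in> g x0 \<Longrightarrow> g x \<inter> V z \<noteq> {}"
    by (rule lower_hemicontinuous_finite_nbhd[of X X g x0 "g x0" V]) (use assms x0 V in auto)
  have "m \<le> card (g x)" if x: "x \<in> U" for x
  proof -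
    obtain h where h: "inj_on h (g x0)" "h ` g x0 \<subseteq> g x"
      using disjoint_transversal[OF V(3), of "g x"] U(3)[OF x] by metis
    have "x \<in> topspace X" using x U(1) openin_subset by blast
    then have "card (g x0) \<le> card (g x)" using h g card_inj_on_le by blast
    with x0 show ?thesis by simp
  qed
  then show "\<exists>T. openin X T \<and> x0 \<in> T \<and> T \<subseteq> {x \<in> topspace X. m \<le> card (g x)}"
    using U(1,2) openin_subset by blast
qed

text \<open>The upper half of continuity, obtained by counting: near \<open>x0\<close> the
  neighbourhoods of the \<open>m\<close> points of \<open>g x0\<close> already account for all
  \<open>m\<close> points of \<open>g x\<close>, leaving none near \<open>y0\<close>.\<close>

lemma n_valued_map_separate:
  assumes X: "Hausdorff_space X" and g: "n_valued_map m X g"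
    and x0: "x0 \<in> topspace X" "y0 \<in> topspace X" "y0 \<notin> g x0"
  obtains U V where "openin X U" "openin X V" "x0 \<in> U" "y0 \<in> V" "\<And>x. x \<in> U \<Longrightarrow> g x \<inter> V = {}"
proof -
  have R: "lower_hemicontinuous X X g"
      "\<And>x. x \<in> topspace X \<Longrightarrow> g x \<subseteq> topspace X \<and> finite (g x) \<and> card (g x) = m"
    using g n_valued_map_iff[OF X] by auto
  \<comment> \<open>\<open>y0\<close> is separated together with the points of \<open>g x0\<close>,
    so that its neighbourhood is disjoint from all of theirs.\<close>
  obtain V where V: "\<And>z. z \<in> insert y0 (g x0) \<Longrightarrow> openin X (V z)"
    "\<And>z. z \<in> insert y0 (g x0) \<Longrightarrow> z \<in> V z" "disjoint_family_on V (insert y0 (g x0))"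
    using Hausdorff_space_separate_finite[OF X, of "insert y0 (g x0)"] R x0
    by (metis finite_insert insert_subset)
  obtain U where U: "openin X U" "x0 \<in> U" "\<And>x z. x \<in> U \<Longrightarrow> z \<in> g x0 \<Longrightarrow> g x \<inter> V z \<noteq> {}"
    by (rule lower_hemicontinuous_finite_nbhd[of X X g x0 "g x0" V]) (use R x0 V in auto)
  have dis: "disjoint_family_on V (g x0)"
    using V(3) by (auto simp: disjoint_family_on_def)
  have "g x \<inter> V y0 = {}" if x: "x \<in> U" for x
  proof -
    obtain h where h: "inj_on h (g x0)" "h ` g x0 \<subseteq> g x" "\<And>z. z \<in> g x0 \<Longrightarrow> h z \<in> V z"
      using disjoint_transversal[OF dis, of "g x"] U(3)[OF x] by metis
    have x': "x \<in> topspace X" using x openin_subset[OF U(1)] by blast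
    have "h ` g x0 = g x"
      using h(1,2) R(2)[OF x'] R(2)[OF x0(1)] by (intro card_subset_eq) (auto simp: card_image)
    moreover have "h z \<notin> V y0" if "z \<in> g x0" for z
    proof -
      have "V z \<inter> V y0 = {}"
        by (rule disjoint_family_onD[OF V(3)]) (use that x0(3) in auto)
      with h(3)[OF that] show ?thesis by blast
    qed
    ultimately show ?thesis by (metis disjoint_iff imageE)
  qed
  moreover have "openin X (V y0)" "y0 \<in> V y0" using V(1,2) by auto
  ultimately show thesis using U(1,2) that by metis
qed

text \<open>A value \<open>y\<close> of \<open>f\<close> outside \<open>g x0\<close> has a
  neighbourhood \<open>W\<close> that \<open>g\<close> avoids near \<open>x0\<close>. Values of
  \<open>f\<close> in \<open>W\<close> therefore survive the subtraction, which gives lower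
  hemicontinuity.\<close>

lemma n_valued_map_diff:
  assumes X: "Hausdorff_space X" and f: "n_valued_map n X f" and g: "n_valued_map m X g"
    and sub: "\<And>x. x \<in> topspace X \<Longrightarrow> g x \<subseteq> f x"
  shows "n_valued_map (n - m) X (\<lambda>x. f x - g x)"
proof -
  have F: "lower_hemicontinuous X X f"
      "\<And>x. x \<in> topspace X \<Longrightarrow> f x \<subseteq> topspace X \<and> finite (f x) \<and> card (f x) = n"
    and G: "\<And>x. x \<in> topspace X \<Longrightarrow> finite (g x) \<and> card (g x) = m"
    using f g n_valued_map_iff[OF X] by auto
  have "openin X {x \<in> topspace X. (f x - g x) \<inter> V \<noteq> {}}" if V: "openin X V" for V
  proof (subst openin_subopen, intro ballI)
    fix x0 assume "x0 \<in> {x \<in> topspace X. (f x - g x) \<inter> V \<noteq> {}}"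
    then obtain y where y: "x0 \<in> topspace X" "y \<in> f x0" "y \<notin> g x0" "y \<in> V" by auto
    then have "y \<in> topspace X" using F by blast
    then obtain U W where UW: "openin X U" "openin X W" "x0 \<in> U" "y \<in> W"
        "\<And>x. x \<in> U \<Longrightarrow> g x \<inter> W = {}"
      using n_valued_map_separate[OF X g y(1) _ y(3)] by metis
    let ?T = "U \<inter> {x \<in> topspace X. f x \<inter> (V \<inter> W) \<noteq> {}}"
    have "openin X ?T"
      using F(1) V UW by (auto simp: lower_hemicontinuous_def)
    moreover have "x0 \<in> ?T" using y UW by blast
    moreover have "?T \<subseteq> {x \<in> topspace X. (f x - g x) \<inter> V \<noteq> {}}" using UW(5) by blast
    ultimately show "\<exists>T. openin X T \<and> x0 \<in> T \<and> T \<subseteq> {x \<in> topspace X. (f x - g x) \<inter> V \<noteq> {}}"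
      by blast
  qed
  moreover have "f x - g x \<subseteq> topspace X \<and> finite (f x - g x) \<and> card (f x - g x) = n - m"
    if "x \<in> topspace X" for x
    using F(2)[OF that] G[OF that] sub[OF that] by (auto simp: card_Diff_subset)
  ultimately show ?thesis
    by (simp add: n_valued_map_iff[OF X] lower_hemicontinuous_def)
qed

section \<open>Graphs and their clopen subsets\<close>

lemma graph_space_eq:
  assumes "n_valued_map n X f"
  shows "graph_space X f = subtopology (prod_topology X X) (Sigma (topspace X) f)"
    and "topspace (graph_space X f) = Sigma (topspace X) f"
proof -
  have "f x \<subseteq> topspace X" if "x \<in> topspace X" for x
    using assms that continuous_map_image_subset_topspace
    unfolding n_valued_map_def by (fastforce simp: topspace_unordered_conf)
  then have "{(x, y). x \<in> topspace X \<and> y \<in> topspace X \<and> y \<in> f x} = Sigma (topspace X) f"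
    and "topspace X \<times> topspace X \<inter> Sigma (topspace X) f = Sigma (topspace X) f"
    by blast+
  then show "graph_space X f = subtopology (prod_topology X X) (Sigma (topspace X) f)"
    and "topspace (graph_space X f) = Sigma (topspace X) f"
    by (auto simp: graph_space_def)
qed

text \<open>The boxes \<open>U\<close> times \<open>V\<close> from
  \<open>n_valued_map_separate\<close> cover the complement and miss the graph.\<close>

lemma closedin_graph:
  assumes X: "Hausdorff_space X" and g: "n_valued_map m X g"
  shows "closedin (prod_topology X X) (Sigma (topspace X) g)"
  unfolding closedin_def
proof
  show "Sigma (topspace X) g \<subseteq> topspace (prod_topology X X)"
    using g n_valued_map_iff[OF X] by auto
  show "openin (prod_topology X X) (topspace (prod_topology X X) - Sigma (topspace X) g)"
    unfolding openin_prod_topology_alt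
  proof (intro allI impI)
    fix x0 y0 assume "(x0, y0) \<in> topspace (prod_topology X X) - Sigma (topspace X) g"
    then have *: "x0 \<in> topspace X" "y0 \<in> topspace X" "y0 \<notin> g x0" by auto
    obtain U V where "openin X U" "openin X V" "x0 \<in> U" "y0 \<in> V" "\<And>x. x \<in> U \<Longrightarrow> g x \<inter> V = {}"
      using n_valued_map_separate[OF X g *] by metis
    moreover from this have "U \<times> V \<subseteq> topspace (prod_topology X X) - Sigma (topspace X) g"
      using openin_subset by fastforce
    ultimately show "\<exists>U V. openin X U \<and> openin X V \<and> x0 \<in> U \<and> y0 \<in> V \<and>
        U \<times> V \<subseteq> topspace (prod_topology X X) - Sigma (topspace X) g" by blast
  qed
qed

text \<open>Inside the graph of \<open>f\<close>, the complement of the graph of \<open>g\<close> is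
  the graph of the difference map, and both graphs are closed.\<close>

lemma clopen_graph_submap:
  assumes X: "Hausdorff_space X" and f: "n_valued_map n X f" and g: "n_valued_map m X g"
    and sub: "\<And>x. x \<in> topspace X \<Longrightarrow> g x \<subseteq> f x"
  shows "closedin (graph_space X f) (Sigma (topspace X) g)"
    and "openin (graph_space X f) (Sigma (topspace X) g)"
proof -
  have cl: "closedin (graph_space X f) (Sigma (topspace X) h)"
    if "n_valued_map j X h" "\<And>x. x \<in> topspace X \<Longrightarrow> h x \<subseteq> f x" for j h
    unfolding graph_space_eq[OF f]
    by (rule closedin_subset_topspace[OF closedin_graph[OF X that(1)]]) (use that(2) in auto)
  show "closedin (graph_space X f) (Sigma (topspace X) g)" by (rule cl[OF g sub])
  have "closedin (graph_space X f) (Sigma (topspace X) (\<lambda>x. f x - g x))"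
    by (rule cl[OF n_valued_map_diff[OF X f g sub]]) auto
  moreover have "topspace (graph_space X f) - Sigma (topspace X) (\<lambda>x. f x - g x) =
      Sigma (topspace X) g"
    using sub unfolding graph_space_eq(2)[OF f] by blast
  ultimately show "openin (graph_space X f) (Sigma (topspace X) g)"
    by (metis closedin_def)
qed

text \<open>An open \<open>A\<close> contains the part of the graph of \<open>f\<close> in a box
  around each of its points. Since \<open>f\<close> is lower hemicontinuous, it keeps a value in
  that box, and this value lies in the fibre of \<open>A\<close>.\<close>

lemma lower_hemicontinuous_open_graph:
  assumes X: "Hausdorff_space X" and f: "n_valued_map n X f" and A: "openin (graph_space X f) A"
  shows "lower_hemicontinuous X X (\<lambda>x. A `` {x})"
  unfolding lower_hemicontinuous_def
proof (intro allI impI)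
  fix V assume V: "openin X V"
  obtain P where P: "openin (prod_topology X X) P" "A = P \<inter> Sigma (topspace X) f"
    using A unfolding graph_space_eq(1)[OF f] openin_subtopology by blast
  show "openin X {x \<in> topspace X. A `` {x} \<inter> V \<noteq> {}}"
  proof (subst openin_subopen, intro ballI)
    fix x0 assume "x0 \<in> {x \<in> topspace X. A `` {x} \<inter> V \<noteq> {}}"
    then obtain y where y: "x0 \<in> topspace X" "(x0, y) \<in> A" "y \<in> V" by auto
    then have "(x0, y) \<in> P" using P by blast
    then obtain U W where UW: "openin X U" "openin X W" "x0 \<in> U" "y \<in> W" "U \<times> W \<subseteq> P"
      using P(1) unfolding openin_prod_topology_alt by metis
    let ?T = "U \<inter> {x \<in> topspace X. f x \<inter> (V \<inter> W) \<noteq> {}}"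
    have "openin X ?T"
      using f V UW by (auto simp: lower_hemicontinuous_def n_valued_map_iff[OF X])
    moreover have "x0 \<in> ?T" using y UW P(2) by blast
    moreover have "?T \<subseteq> {x \<in> topspace X. A `` {x} \<inter> V \<noteq> {}}" using UW(5) P(2) by blast
    ultimately show "\<exists>T. openin X T \<and> x0 \<in> T \<and> T \<subseteq> {x \<in> topspace X. A `` {x} \<inter> V \<noteq> {}}"
      by blast
  qed
qed

text \<open>Only constancy of the fibre size is at stake: the size over a base point
  \<open>a\<close> determines a level set \<open>?E\<close> that is clopen and nonempty, hence
  everything.\<close>

lemma n_valued_map_clopen_fiber:
  assumes X: "Hausdorff_space X" "connected_space X" and f: "n_valued_map n X f"
    and A: "openin (graph_space X f) A" "closedin (graph_space X f) A"
  obtains m where "n_valued_map m X (\<lambda>x. A `` {x})"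
\<comment> \<open>Over an empty base there is no fibre to measure, and the size \<open>0\<close> is
  supplied.\<close>
proof (cases "topspace X = {}")
  case True
  then have "n_valued_map 0 X (\<lambda>x. A `` {x})"
    by (simp add: n_valued_map_def)
  with that show thesis .
next
  case False
  then obtain a where a: "a \<in> topspace X" by blast
  let ?B = "topspace (graph_space X f) - A"
  have F: "\<And>x. x \<in> topspace X \<Longrightarrow> f x \<subseteq> topspace X \<and> finite (f x) \<and> card (f x) = n"
    using f n_valued_map_iff[OF X(1)] by auto
  have Asub: "A \<subseteq> Sigma (topspace X) f"
    using A(1) openin_subset graph_space_eq(2)[OF f] by metis
  have un: "A `` {x} \<union> ?B `` {x} = f x" "A `` {x} \<inter> ?B `` {x} = {}" if "x \<in> topspace X" for x
    using Asub that unfolding graph_space_eq(2)[OF f] by auto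
  have sub: "A `` {x} \<subseteq> topspace X \<and> finite (A `` {x})" "?B `` {x} \<subseteq> topspace X \<and> finite (?B `` {x})"
    if "x \<in> topspace X" for x
    using un[OF that] F[OF that] by (metis finite_Un le_sup_iff)+
  have card: "card (A `` {x}) + card (?B `` {x}) = n" if "x \<in> topspace X" for x
    using un[OF that] F[OF that] sub[OF that] card_Un_disjoint by metis
  have lA: "lower_hemicontinuous X X (\<lambda>x. A `` {x})"
    by (rule lower_hemicontinuous_open_graph[OF X(1) f A(1)])
  have lB: "lower_hemicontinuous X X (\<lambda>x. ?B `` {x})"
    by (rule lower_hemicontinuous_open_graph[OF X(1) f]) (use A(2) in \<open>simp add: closedin_def\<close>)
  have open_ge: "openin X {x \<in> topspace X. m \<le> card (A `` {x})}" for m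
    by (rule openin_card_ge[OF X(1) lA]) (use sub in blast)
  \<comment> \<open>The two fibre sizes sum to \<open>n\<close>, so an upper bound for
    \<open>A\<close> is a lower bound for its complement \<open>?B\<close>, and lower bounds are
    open conditions.\<close>
  have open_le: "openin X {x \<in> topspace X. card (A `` {x}) \<le> m}" if "m \<le> n" for m
  proof -
    have "{x \<in> topspace X. card (A `` {x}) \<le> m} = {x \<in> topspace X. n - m \<le> card (?B `` {x})}"
      using card that by fastforce
    moreover have "openin X {x \<in> topspace X. n - m \<le> card (?B `` {x})}"
      by (rule openin_card_ge[OF X(1) lB]) (use sub(2) in blast)
    ultimately show ?thesis by simp
  qed
  define m where "m = card (A `` {a})"
  have "m \<le> n" using card[OF a] by (simp add: m_def)
  let ?E = "{x \<in> topspace X. card (A `` {x}) = m}"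
  have "?E = {x \<in> topspace X. m \<le> card (A `` {x})} \<inter> {x \<in> topspace X. card (A `` {x}) \<le> m}"
    by auto
  also have "openin X \<dots>"
    by (rule openin_Int[OF open_ge open_le[OF \<open>m \<le> n\<close>]])
  finally have "openin X ?E" .
  moreover have "openin X (topspace X - ?E)"
  proof -
    \<comment> \<open>Off the level set the size is at least \<open>m + 1\<close> or at most
      \<open>m - 1\<close>. For \<open>m = 0\<close> truncated subtraction would turn the second
      case into the level set itself, hence the case split.\<close>
    have "topspace X - ?E = {x \<in> topspace X. Suc m \<le> card (A `` {x})} \<union>
        (if m = 0 then {} else {x \<in> topspace X. card (A `` {x}) \<le> m - 1})"
      by (auto split: if_splits)
    then show ?thesis using open_ge open_le \<open>m \<le> n\<close> by auto
  qed
  then have "closedin X ?E" by (auto simp: closedin_def)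
  ultimately have "?E = topspace X"
    using X(2) a unfolding connected_space_clopen_in m_def by blast
  then have "n_valued_map m X (\<lambda>x. A `` {x})"
    using lA sub n_valued_map_iff[OF X(1)] by blast
  with that show thesis .
qed

section \<open>Irreducibility and connectedness of the graph\<close>

text \<open>Clopen subsets of the graph and submaps determine each other, so a proper nonempty
  clopen subset is the same as a proper submap. The point \<open>a\<close> of the nonempty base is
  where a submap is seen to be proper.\<close>

lemma irreducible_map_iff_connected_graph:
  assumes X: "Hausdorff_space X" "connected_space X" and f: "n_valued_map n X f"
    and ne: "topspace X \<noteq> {}"
  shows "irreducible_map n X f \<longleftrightarrow> connected_space (graph_space X f)"
proof -
  obtain a where a: "a \<in> topspace X" using ne by blast
  have F: "\<And>x. x \<in> topspace X \<Longrightarrow> f x \<subseteq> topspace X \<and> finite (f x) \<and> card (f x) = n"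
    using f n_valued_map_iff[OF X(1)] by auto
  note top = graph_space_eq(2)[OF f]
  show ?thesis
  proof
    assume irr: "irreducible_map n X f"
    show "connected_space (graph_space X f)"
      unfolding connected_space_clopen_in
    proof (intro allI impI)
      fix A assume A: "openin (graph_space X f) A \<and> closedin (graph_space X f) A"
      then obtain m where m: "n_valued_map m X (\<lambda>x. A `` {x})"
        using n_valued_map_clopen_fiber[OF X f] by metis
      have M: "\<And>x. x \<in> topspace X \<Longrightarrow> finite (A `` {x}) \<and> card (A `` {x}) = m"
        using m n_valued_map_iff[OF X(1)] by auto
      have Asub: "A \<subseteq> Sigma (topspace X) f" using A openin_subset top by metis
      then have sub: "A `` {x} \<subseteq> f x" for x by blast
      show "A = {} \<or> A = topspace (graph_space X f)"
      proof (cases "A = {}")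
        case False
        then obtain b c where bc: "(b, c) \<in> A" by auto
        then have b: "b \<in> topspace X" using Asub by blast
        \<comment> \<open>A single point of \<open>A\<close> makes the constant fibre size positive,
          as a submap requires.\<close>
        have "0 < m" using M[OF b] bc by (auto simp: card_gt_0_iff)
        moreover have "m \<le> n" using M[OF b] F[OF b] sub by (metis card_mono)
        moreover have "\<not> (submap m (\<lambda>x. A `` {x}) n X f \<and> m < n)"
          using irr by (auto simp: irreducible_map_def)
        ultimately have "m = n" using m sub by (auto simp: submap_def)
        then have "A `` {x} = f x" if "x \<in> topspace X" for x
          using M F sub that by (metis card_subset_eq)
        then show ?thesis using Asub unfolding top by blast
      qed simp
    qed
  next
    assume con: "connected_space (graph_space X f)"
    have False if g: "submap k g n X f" "k < n" for k g
    proof -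
      have k: "0 < k" "n_valued_map k X g" "\<And>x. x \<in> topspace X \<Longrightarrow> g x \<subseteq> f x"
        using g by (auto simp: submap_def)
      have ga: "card (g a) = k" using k(2) a n_valued_map_iff[OF X(1)] by auto
      have "Sigma (topspace X) g = {} \<or> Sigma (topspace X) g = Sigma (topspace X) f"
        using con clopen_graph_submap[OF X(1) f k(2,3)] unfolding connected_space_clopen_in top by blast
      \<comment> \<open>Since \<open>g a\<close> has \<open>k\<close> elements with
        \<open>0 < k < n\<close>, it is neither empty nor \<open>f a\<close>.\<close>
      then have "g a = {} \<or> g a = f a" using a by blast
      then show False using ga k(1) g(2) F[OF a] by auto
    qed
    then show "irreducible_map n X f" using f by (auto simp: irreducible_map_def)
  qed
qed

section \<open>Irreducible partitions and components of the graph\<close>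

text \<open>A connected piece lies in the component of each of its points, and that component, being
  connected, lies in any clopen piece it meets.\<close>

lemma bij_betw_connected_components_of:
  assumes C: "\<And>i. i \<in> I \<Longrightarrow> connectedin Y (C i)" "\<And>i. i \<in> I \<Longrightarrow> openin Y (C i)"
      "\<And>i. i \<in> I \<Longrightarrow> closedin Y (C i)" "\<And>i. i \<in> I \<Longrightarrow> C i \<noteq> {}"
    and dis: "disjoint_family_on C I" and un: "(\<Union>i\<in>I. C i) = topspace Y"
  shows "bij_betw C I (connected_components_of Y)"
proof -
  have eq: "connected_component_of_set Y y = C i" if i: "i \<in> I" and y: "y \<in> C i" for i y
  proof
    show "C i \<subseteq> connected_component_of_set Y y"
      by (rule connected_component_of_maximal[OF C(1)[OF i] y])
    have "y \<in> topspace Y" using i y un by blast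
    then have "\<not> disjnt (connected_component_of_set Y y) (C i)"
      using y connected_component_of_refl[of Y y] by (auto simp: disjnt_iff)
    then show "connected_component_of_set Y y \<subseteq> C i"
      using connectedin_clopen_cases[OF connectedin_connected_component_of C(3)[OF i] C(2)[OF i]]
      by metis
  qed
  have "inj_on C I"
    using dis C(4) unfolding inj_on_def disjoint_family_on_def by (metis inf.idem)
  moreover have "C i \<in> connected_components_of Y" if i: "i \<in> I" for i
  proof -
    obtain y where y: "y \<in> C i" using C(4)[OF i] by blast
    then have "y \<in> topspace Y" using un i by blast
    then show ?thesis using eq[OF i y] by (auto simp: connected_components_of_def)
  qed
  moreover have "Z \<in> C ` I" if Z: "Z \<in> connected_components_of Y" for Z
  proof -
    obtain y where "y \<in> topspace Y" "Z = connected_component_of_set Y y"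
      using Z unfolding connected_components_of_def by blast
    with eq un show ?thesis by blast
  qed
  ultimately show ?thesis by (auto simp: bij_betw_def)
qed

text \<open>The graph of \<open>g\<close> carries the subspace topology from the graph of
  \<open>f\<close>, so its connectedness can be tested there.\<close>

lemma connected_space_subgraph:
  assumes f: "n_valued_map n X f" and g: "n_valued_map m X g"
    and sub: "\<And>x. x \<in> topspace X \<Longrightarrow> g x \<subseteq> f x"
  shows "connected_space (graph_space X g) \<longleftrightarrow> connectedin (graph_space X f) (Sigma (topspace X) g)"
proof -
  have "Sigma (topspace X) f \<inter> Sigma (topspace X) g = Sigma (topspace X) g" using sub by blast
  then have "subtopology (graph_space X f) (Sigma (topspace X) g) = graph_space X g"
    by (simp add: graph_space_eq(1)[OF f] graph_space_eq(1)[OF g] subtopology_subtopology)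
  moreover have "Sigma (topspace X) g \<subseteq> topspace (graph_space X f)"
    using sub graph_space_eq(2)[OF f] by auto
  ultimately show ?thesis by (simp add: connectedin_def)
qed

text \<open>The cardinalities of the parts sum to that of their union, so no point can be counted
  twice.\<close>

lemma map_partition_disjoint:
  assumes X: "Hausdorff_space X" and f: "n_valued_map n X f"
    and part: "map_partition n X f k ks fs" and x: "x \<in> topspace X"
  shows "disjoint_family_on (\<lambda>i. fs i x) {..<k}"
proof -
  have fs: "finite (fs i x)" "card (fs i x) = ks i" if "i < k" for i
    using part that x n_valued_map_iff[OF X] by (auto simp: map_partition_def)
  have "card (\<Union>i<k. fs i x) = n" "(\<Sum>i<k. ks i) = n"
    using part x f n_valued_map_iff[OF X] by (auto simp: map_partition_def)
  then have eq: "card (\<Union>i<k. fs i x) = (\<Sum>i<k. card (fs i x))" using fs by simp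
  show ?thesis
    unfolding disjoint_family_on_def
  proof (intro ballI impI)
    fix i j assume ij: "i \<in> {..<k}" "j \<in> {..<k}" "i \<noteq> j"
    show "fs i x \<inter> fs j x = {}"
    proof (rule ccontr)
      assume "fs i x \<inter> fs j x \<noteq> {}"
      moreover have fin: "finite (\<Union>l\<in>{..<k} - {i}. fs l x)" using fs by auto
      \<comment> \<open>Part \<open>i\<close> is weighed against the union of all others;
        inclusion-exclusion with a positive overlap makes the union smaller than the sum of the
        sizes.\<close>
      ultimately have pos: "0 < card (fs i x \<inter> (\<Union>l\<in>{..<k} - {i}. fs l x))"
        using ij by (subst card_gt_0_iff) auto
      have "(\<Union>l<k. fs l x) = fs i x \<union> (\<Union>l\<in>{..<k} - {i}. fs l x)" using ij by auto
      then have "card (fs i x) + card (\<Union>l\<in>{..<k} - {i}. fs l x) =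
          card (\<Union>l<k. fs l x) + card (fs i x \<inter> (\<Union>l\<in>{..<k} - {i}. fs l x))"
        using card_Un_Int[OF _ fin, of "fs i x"] fs ij by simp
      moreover have "card (\<Union>l\<in>{..<k} - {i}. fs l x) \<le> (\<Sum>l\<in>{..<k} - {i}. card (fs l x))"
        by (rule card_UN_le) simp
      moreover have "(\<Sum>l<k. card (fs l x)) = card (fs i x) + (\<Sum>l\<in>{..<k} - {i}. card (fs l x))"
        using ij by (intro sum.remove) auto
      ultimately show False using pos eq by linarith
    qed
  qed
qed

text \<open>The graphs of the parts are connected by irreducibility, clopen as graphs of submaps,
  nonempty, disjoint and covering, which characterizes the components.\<close>

lemma irreducible_partition_components:
  assumes X: "Hausdorff_space X" "connected_space X" "topspace X \<noteq> {}"
    and f: "n_valued_map n X f" and irr: "irreducible_partition n X f k fs"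
  shows "bij_betw (\<lambda>i. Sigma (topspace X) (fs i)) {..<k} (connected_components_of (graph_space X f))"
proof -
  obtain ks where part: "map_partition n X f k ks fs"
      and ir: "\<And>i. i < k \<Longrightarrow> irreducible_map (ks i) X (fs i)"
    using irr by (auto simp: irreducible_partition_def)
  have fs: "0 < ks i" "n_valued_map (ks i) X (fs i)" "\<And>x. x \<in> topspace X \<Longrightarrow> fs i x \<subseteq> f x"
    if "i < k" for i
    using part that by (auto simp: map_partition_def)
  obtain a where a: "a \<in> topspace X" using X(3) by blast
  show ?thesis
  proof (rule bij_betw_connected_components_of)
    fix i assume "i \<in> {..<k}"
    then have i: "i < k" by simp
    note fs = fs[OF i]
    show "connectedin (graph_space X f) (Sigma (topspace X) (fs i))"
      using irreducible_map_iff_connected_graph[OF X(1,2) fs(2) X(3)] ir[OF i]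
        connected_space_subgraph[OF f fs(2,3)] by simp
    show "openin (graph_space X f) (Sigma (topspace X) (fs i))"
      "closedin (graph_space X f) (Sigma (topspace X) (fs i))"
      using clopen_graph_submap[OF X(1) f fs(2,3)] by auto
    have "card (fs i a) = ks i" using fs(2) a n_valued_map_iff[OF X(1)] by auto
    then have "fs i a \<noteq> {}" using fs(1) by auto
    then show "Sigma (topspace X) (fs i) \<noteq> {}" using a by blast
  next
    show "disjoint_family_on (\<lambda>i. Sigma (topspace X) (fs i)) {..<k}"
      using map_partition_disjoint[OF X(1) f part] unfolding disjoint_family_on_def by blast
    show "(\<Union>i<k. Sigma (topspace X) (fs i)) = topspace (graph_space X f)"
      using part unfolding graph_space_eq(2)[OF f] map_partition_def by auto
  qed
qed

text \<open>Each component is read as a relation, and its fibres are the values of a part.\<close>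

lemma irreducible_partition_of_components:
  assumes X: "Hausdorff_space X" "connected_space X" "topspace X \<noteq> {}"
    and f: "n_valued_map n X f"
    and C: "bij_betw C {..<k} (connected_components_of (graph_space X f))"
  shows "irreducible_partition n X f k (\<lambda>i x. C i `` {x})"
proof -
  let ?G = "graph_space X f"
  obtain a where a: "a \<in> topspace X" using X(3) by blast
  have comp: "C i \<in> connected_components_of ?G" if "i < k" for i
    using C that by (auto simp: bij_betw_def)
  have fin: "finite (connected_components_of ?G)"
    using C bij_betw_finite by blast
  have Csub: "C i \<subseteq> Sigma (topspace X) f" if "i < k" for i
    using connected_components_of_subset[OF comp[OF that]] graph_space_eq(2)[OF f] by simp
  then have sub: "C i `` {x} \<subseteq> f x" if "i < k" for i x
    using that by blast
  \<comment> \<open>Components are always closed; being finite in number they are also open, so each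
    has fibres of constant size.\<close>
  have "\<exists>m. n_valued_map m X (\<lambda>x. C i `` {x})" if "i < k" for i
    using n_valued_map_clopen_fiber[OF X(1,2) f, of "C i"] comp[OF that]
      open_in_finite_connected_components[OF fin] closedin_connected_components_of by metis
  then obtain ks where ks: "\<And>i. i < k \<Longrightarrow> n_valued_map (ks i) X (\<lambda>x. C i `` {x})"
    by metis
  have card: "finite (C i `` {x})" "card (C i `` {x}) = ks i" if "i < k" "x \<in> topspace X" for i x
    using ks[OF that(1)] that(2) n_valued_map_iff[OF X(1)] by auto
  have pos: "0 < ks i" if i: "i < k" for i
  proof -
    obtain b c where bc: "(b, c) \<in> C i"
      using nonempty_connected_components_of[OF comp[OF i]] by auto
    then have "b \<in> topspace X" using Csub[OF i] by blast
    then show ?thesis using card[OF i] bc by (metis Image_singleton_iff card_gt_0_iff empty_iff)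
  qed
  have un: "f x = (\<Union>i<k. C i `` {x})" if "x \<in> topspace X" for x
  proof -
    have "(\<Union>i<k. C i) = Sigma (topspace X) f"
      using C Union_connected_components_of[of ?G] graph_space_eq(2)[OF f]
      by (simp add: bij_betw_def)
    then show ?thesis using that by blast
  qed
  have dis: "C i \<inter> C j = {}" if "i < k" "j < k" "i \<noteq> j" for i j
  proof -
    have "C i \<noteq> C j" using C that by (auto simp: bij_betw_def inj_on_def)
    then show ?thesis
      using pairwise_disjoint_connected_components_of[of ?G] comp that
      unfolding pairwise_def disjnt_def by blast
  qed
  \<comment> \<open>The sizes \<open>ks i\<close> do not depend on the point, so counting the
    disjoint fibres over the one point \<open>a\<close> gives their sum.\<close>
  have "card (f a) = (\<Sum>i<k. card (C i `` {a}))"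
    unfolding un[OF a] using card(1) a dis by (intro card_UN_disjoint) blast+
  then have "(\<Sum>i<k. ks i) = n"
    using card(2) a f n_valued_map_iff[OF X(1)] by simp
  then have "map_partition n X f k ks (\<lambda>i x. C i `` {x})"
    using pos ks un by (simp add: map_partition_def)
  moreover have "irreducible_map (ks i) X (\<lambda>x. C i `` {x})" if i: "i < k" for i
  proof -
    have "Sigma (topspace X) (\<lambda>x. C i `` {x}) = C i" using Csub[OF i] by blast
    then have "connected_space (graph_space X (\<lambda>x. C i `` {x}))"
      using connected_space_subgraph[OF f ks[OF i] sub[OF i]]
        connectedin_connected_components_of[OF comp[OF i]] by simp
    then show ?thesis
      using irreducible_map_iff_connected_graph[OF X(1,2) ks[OF i] X(3)] by simp
  qed
  ultimately show ?thesis by (auto simp: irreducible_partition_def)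
qed

section \<open>Recovering the parts from the component maps over a polyhedron\<close>

lemma fiber_image_snd_fst_Sigma:
  "x \<in> S \<Longrightarrow> fiber_image snd fst (Sigma S g) x = g x"
  by (force simp: fiber_image_def)

theorem theorem7p2:
  fixes X :: "'a topology"
    and \<K> :: "'e::euclidean_space set set"
    and f :: "'a \<Rightarrow> 'a set"
    and n k :: nat
    and Xhat :: "('a \<times> 'a) topology"
    and q F :: "'a \<times> 'a \<Rightarrow> 'a"
  assumes "triangulated_by X \<K>"
    and "connected_space X" and "topspace X \<noteq> {}"
    and "1 \<le> n"
    and "n_valued_map n X f"
    and "Xhat = graph_space X f" and "q = fst" and "F = snd"
  shows "((\<exists>fs. irreducible_partition n X f k fs) \<longleftrightarrow>
            finite (connected_components_of Xhat) \<and> card (connected_components_of Xhat) = k) \<and>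
         (\<forall>fs. irreducible_partition n X f k fs \<longrightarrow>
            (\<exists>C. bij_betw C {..<k} (connected_components_of Xhat) \<and>
                 (\<forall>i<k. \<forall>x \<in> topspace X. fs i x = fiber_image F q (C i) x)))"
proof -
  \<comment> \<open>A polyhedron is homeomorphic to a subspace of a Euclidean space.\<close>
  have X: "Hausdorff_space X"
    using assms(1) Hausdorff_space_subtopology[OF Hausdorff_space_euclidean]
      homeomorphic_Hausdorff_space unfolding triangulated_by_def by metis
  note X = X assms(2,3)
  have part: "bij_betw (\<lambda>i. Sigma (topspace X) (fs i)) {..<k} (connected_components_of Xhat)"
    if "irreducible_partition n X f k fs" for fs
    using irreducible_partition_components[OF X assms(5) that] assms(6) by simp
  have "\<exists>fs. irreducible_partition n X f k fs"
    if fin: "finite (connected_components_of Xhat)"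
      and card: "card (connected_components_of Xhat) = k"
  proof -
    obtain C where "bij_betw C {..<k} (connected_components_of Xhat)"
      using ex_bij_betw_nat_finite[OF fin] card by (auto simp: atLeast0LessThan)
    then show ?thesis
      using irreducible_partition_of_components[OF X assms(5)] assms(6) by blast
  qed
  moreover have "finite (connected_components_of Xhat)" "card (connected_components_of Xhat) = k"
    if "irreducible_partition n X f k fs" for fs
    using bij_betw_finite[OF part[OF that]] bij_betw_same_card[OF part[OF that]] by auto
  moreover have "\<exists>C. bij_betw C {..<k} (connected_components_of Xhat) \<and>
      (\<forall>i<k. \<forall>x \<in> topspace X. fs i x = fiber_image F q (C i) x)"
    if "irreducible_partition n X f k fs" for fs
    using part[OF that] assms(7,8)
    \<comment> \<open>The component matched with \<open>fs i\<close> is its own graph, over which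
      the component map returns \<open>fs i\<close>.\<close>
    by (intro exI[of _ "\<lambda>i. Sigma (topspace X) (fs i)"]) (simp add: fiber_image_snd_fst_Sigma)
  ultimately show ?thesis by blast
qed

end
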